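(* Let $G$ be a finite, simple, connected hamiltonian graph on at least $3$ vertices with maximum degree $\Delta(G)\leq 3$. Then the line graph $L(G)$ has the PMH--property, i.e. every perfect matching of $L(G)$ is contained in some hamiltonian cycle of $L(G)$.
   Context: The line graph $L(G)$ has vertex set $E(G)$, two vertices being adjacent when the corresponding edges of $G$ share an end-vertex. A graph has the Perfect--Matching--Hamiltonian property (PMH--property) if each of its perfect matchings can be extended to (i.e. is a subset of the edge set of) a hamiltonian cycle of the graph. *)

theory Defs
  imports Main "HOL-Library.Disjoint_Sets"
begin

text \<open>
  A simple graph is a pair of a vertex set and a set of two-element edges
  (so there are neither loops nor parallel edges).
\<close>

type_synonym 'a ugraph = "'a set \<times> 'a set set"

abbreviation verts :: "'a ugraph \<Rightarrow> 'a set" where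
  "verts G \<equiv> fst G"

abbreviation edges :: "'a ugraph \<Rightarrow> 'a set set" where
  "edges G \<equiv> snd G"

definition simple_graph :: "'a ugraph \<Rightarrow> bool" where
  "simple_graph G \<longleftrightarrow> (\<forall>e\<in>edges G. e \<subseteq> verts G \<and> card e = 2)"

definition connected_graph :: "'a ugraph \<Rightarrow> bool" where
  "connected_graph G \<longleftrightarrow> verts G \<noteq> {} \<and>
     (\<forall>u\<in>verts G. \<forall>v\<in>verts G. (u, v) \<in> {(x, y). {x, y} \<in> edges G}\<^sup>*)"

definition degree :: "'a ugraph \<Rightarrow> 'a \<Rightarrow> nat" where
  "degree G v = card {e \<in> edges G. v \<in> e}"

text \<open>Only meaningful for a finite nonempty vertex set.\<close>

definition max_degree :: "'a ugraph \<Rightarrow> nat" where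
  "max_degree G = Max (degree G ` verts G)"

text \<open>
  A cycle is given by the list of its vertices in cyclic order, without repeating
  the first vertex at the end; the index is taken modulo the length to include the
  edge joining the last vertex to the first.
\<close>

definition cycle_edges :: "'a list \<Rightarrow> 'a set set" where
  "cycle_edges c = {{c ! i, c ! (Suc i mod length c)} | i. i < length c}"

definition is_cycle :: "'a ugraph \<Rightarrow> 'a list \<Rightarrow> bool" where
  "is_cycle G c \<longleftrightarrow> 3 \<le> length c \<and> distinct c \<and> set c \<subseteq> verts G \<and> cycle_edges c \<subseteq> edges G"

definition hamiltonian_cycle :: "'a ugraph \<Rightarrow> 'a list \<Rightarrow> bool" where
  "hamiltonian_cycle G c \<longleftrightarrow> is_cycle G c \<and> set c = verts G"

definition hamiltonian :: "'a ugraph \<Rightarrow> bool" where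
  "hamiltonian G \<longleftrightarrow> (\<exists>c. hamiltonian_cycle G c)"

definition perfect_matching :: "'a ugraph \<Rightarrow> 'a set set \<Rightarrow> bool" where
  "perfect_matching G M \<longleftrightarrow> M \<subseteq> edges G \<and> disjoint M \<and> \<Union>M = verts G"

text \<open>A graph without perfect matchings has the property vacuously.\<close>

definition PMH_property :: "'a ugraph \<Rightarrow> bool" where
  "PMH_property G \<longleftrightarrow>
     (\<forall>M. perfect_matching G M \<longrightarrow> (\<exists>c. hamiltonian_cycle G c \<and> M \<subseteq> cycle_edges c))"

definition line_graph :: "'a ugraph \<Rightarrow> 'a set ugraph" where
  "line_graph G =
     (edges G, {{e, f} | e f. e \<in> edges G \<and> f \<in> edges G \<and> e \<noteq> f \<and> e \<inter> f \<noteq> {}})"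

lemma simple_graph_line_graph: "simple_graph (line_graph G)"
  by (auto simp: simple_graph_def line_graph_def card_2_iff)

end

theory Submission
  imports Defs
begin

text \<open>
  Let \<open>C\<close> be a hamiltonian cycle of \<open>G\<close>. Since degrees are at most 3, every vertex lies on at most
  one chord of \<open>C\<close>, so a perfect matching \<open>M\<close> of the line graph pairs each chord with an
  edge of \<open>C\<close>, and the two meet in one end-vertex of the chord. Walk along the edges of \<open>C\<close>
  and, at each vertex, insert the chord whose partner meets it there, if there is one. This visits
  every edge of \<open>G\<close> once and traverses the pairs of \<open>M\<close> that contain a chord. A pair of two
  consecutive cycle edges is traversed as well: a chord inserted between them would be
  matched to one of them.
\<close>

section \<open>Edge sets of paths and cycles given as lists\<close>

fun path_edges :: "'a list \<Rightarrow> 'a set set" where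
  "path_edges (x # y # zs) = insert {x, y} (path_edges (y # zs))"
| "path_edges xs = {}"

text \<open>The entry \<open>y\<close> at the cut belongs to both parts, so the edge that enters
  \<open>y\<close> and the edge that leaves it are both counted.\<close>

lemma path_edges_append:
  "path_edges (xs @ y # zs) = path_edges (xs @ [y]) \<union> path_edges (y # zs)"
proof (induction xs rule: path_edges.induct)
  case ("2_2" x)
  then show ?case by (cases zs) auto
qed auto

lemma path_edges_conv_nth:
  "path_edges xs = {{xs ! i, xs ! Suc i} | i. Suc i < length xs}"
proof (induction xs rule: path_edges.induct)
  case (1 x y zs)
  have "{{(x # y # zs) ! i, (x # y # zs) ! Suc i} | i. Suc i < length (x # y # zs)}
      = insert {x, y} {{(y # zs) ! i, (y # zs) ! Suc i} | i. Suc i < length (y # zs)}"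
    (is "?L = ?R")
  proof
    show "?L \<subseteq> ?R"
    proof
      fix s assume "s \<in> ?L"
      then obtain i where "s = {(x # y # zs) ! i, (x # y # zs) ! Suc i}" "Suc i < length (x # y # zs)"
        by blast
      then show "s \<in> ?R" by (cases i) auto
    qed
    show "?R \<subseteq> ?L"
    proof
      fix s assume "s \<in> ?R"
      then consider "s = {x, y}" | i where "s = {(y # zs) ! i, (y # zs) ! Suc i}" "Suc i < length (y # zs)"
        by blast
      then show "s \<in> ?L"
      proof cases
        case 1
        then show ?thesis by (intro CollectI exI[of _ 0]) auto
      next
        case (2 i)
        then show ?thesis by (intro CollectI exI[of _ "Suc i"]) auto
      qed
    qed
  qed
  with 1 show ?case by simp
qed auto

lemma cycle_edges_conv_path_edges:
  assumes "xs \<noteq> []"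
  shows "cycle_edges xs = path_edges (xs @ [hd xs])"
proof -
  have "{(xs @ [hd xs]) ! i, (xs @ [hd xs]) ! Suc i} = {xs ! i, xs ! (Suc i mod length xs)}"
    if "i < length xs" for i
    using that assms by (cases "Suc i = length xs") (auto simp: nth_append hd_conv_nth)
  then show ?thesis
    unfolding cycle_edges_def path_edges_conv_nth by (auto; metis)
qed

text \<open>Each block \<open>e i # x i\<close> is closed with the head of the next block, so the
  edges joining consecutive blocks are included. A long walk can thus be checked one block at a
  time.\<close>

lemma path_edges_concat:
  "path_edges (concat (map (\<lambda>i. e i # x i) [0..<m]) @ [e m])
     = (\<Union>i<m. path_edges (e i # x i @ [e (Suc i)]))"
proof (induction m)
  case (Suc m)
  have "path_edges (concat (map (\<lambda>i. e i # x i) [0..<Suc m]) @ [e (Suc m)])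
      = path_edges (concat (map (\<lambda>i. e i # x i) [0..<m]) @ e m # x m @ [e (Suc m)])"
    by simp
  also have "\<dots> = path_edges (concat (map (\<lambda>i. e i # x i) [0..<m]) @ [e m])
      \<union> path_edges (e m # x m @ [e (Suc m)])"
    by (rule path_edges_append)
  finally show ?case using Suc by (auto simp: lessThan_Suc)
qed simp

text \<open>For a chord and its partner in \<open>M\<close>, this pins down the only vertex at which
  the chord can be inserted.\<close>

lemma card_2_eq_if_common_points:
  assumes "card e = 2" "card f = 2" "e \<noteq> f" "a \<in> e" "a \<in> f" "b \<in> e" "b \<in> f"
  shows "a = b"
  using assms by (auto simp: card_2_iff)

theorem theorem2:
  fixes G :: "'a ugraph"
  assumes "finite (verts G)"
    and "simple_graph G"
    and "connected_graph G"
    and "hamiltonian G"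
    and "3 \<le> card (verts G)"
    and "max_degree G \<le> 3"
  shows "PMH_property (line_graph G)"
  unfolding PMH_property_def
proof (intro allI impI)
  fix M assume M: "perfect_matching (line_graph G) M"
  have M_line: "M \<subseteq> edges (line_graph G)" and "disjoint M" and M_cover: "\<Union>M = edges G"
    using M by (auto simp: perfect_matching_def line_graph_def)
  have M_unique: "s = t" if "s \<in> M" "t \<in> M" "a \<in> s" "a \<in> t" for s t a
    using \<open>disjoint M\<close> that by (auto simp: disjoint_def)
  have M_pair: "\<exists>g. s = {f, g} \<and> f \<noteq> g \<and> f \<in> edges G \<and> g \<in> edges G \<and> f \<inter> g \<noteq> {}"
    if "s \<in> M" "f \<in> s" for s f
  proof -
    have "s \<in> edges (line_graph G)" using M_line that by blast
    then obtain a b where "s = {a, b}" "a \<in> edges G" "b \<in> edges G" "a \<noteq> b" "a \<inter> b \<noteq> {}"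
      unfolding line_graph_def by auto
    then show ?thesis using that(2)
      by (cases "f = a") (auto simp: Int_commute insert_commute)
  qed
  have edge: "f \<subseteq> verts G" "card f = 2" if "f \<in> edges G" for f
    using assms(2) that by (auto simp: simple_graph_def)
  have "finite (edges G)"
    by (rule finite_subset[of _ "Pow (verts G)"]) (use edge(1) assms(1) in blast)+
  have degree_le: "card {f \<in> edges G. w \<in> f} \<le> 3" if "w \<in> verts G" for w
  proof -
    have "degree G w \<le> max_degree G"
      unfolding max_degree_def using assms(1) that by (intro Max_ge) auto
    then show ?thesis using assms(6) by (simp add: degree_def)
  qed

  \<comment> \<open>The hamiltonian cycle of \<open>G\<close> and its chords\<close>
  obtain c where "hamiltonian_cycle G c"
    using assms(4) by (auto simp: hamiltonian_def)
  define n where "n = length c"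
  have "n \<ge> 3" and "distinct c" and c_set: "set c = verts G" and c_edges: "cycle_edges c \<subseteq> edges G"
    using \<open>hamiltonian_cycle G c\<close> by (auto simp: hamiltonian_cycle_def is_cycle_def n_def)
  \<comment> \<open>Reducing indices modulo \<open>n\<close> makes \<open>v\<close> and
    \<open>e\<close> periodic, so the wrap-around needs no special case. The cycle edges at the
    vertex \<open>v (Suc i)\<close> are \<open>e i\<close> and \<open>e (Suc i)\<close>, which is
    why vertices are addressed in the form \<open>v (Suc i)\<close> below.\<close>
  define v where "v i = c ! (i mod n)" for i
  define e where "e i = {v i, v (Suc i)}" for i
  have v_in_e: "v (Suc i) \<in> e i" "v (Suc i) \<in> e (Suc i)" for i by (simp_all add: e_def)
  have v_eq_iff: "v i = v j \<longleftrightarrow> i mod n = j mod n" for i j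
  proof -
    have "i mod n < n" "j mod n < n" using \<open>n \<ge> 3\<close> by simp_all
    then show ?thesis using \<open>distinct c\<close> by (simp add: v_def n_def nth_eq_iff_index_eq)
  qed
  have v_in: "v i \<in> verts G" for i
  proof -
    have "i mod n < n" using \<open>n \<ge> 3\<close> by simp
    then show ?thesis by (simp add: v_def n_def flip: c_set)
  qed
  have v_surj: "\<exists>i<n. w = v (Suc i)" if w: "w \<in> verts G" for w
  proof -
    obtain j where j: "j < n" "w = c ! j"
      using w by (auto simp: n_def in_set_conv_nth simp flip: c_set)
    show ?thesis
    proof (cases j)
      case 0
      \<comment> \<open>The vertex \<open>v 0\<close> is reached by wrapping around, as
        \<open>v n\<close>.\<close>
      then show ?thesis using j by (intro exI[of _ "n - 1"]) (auto simp: v_def)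
    next
      case (Suc i)
      then show ?thesis using j by (intro exI[of _ i]) (auto simp: v_def)
    qed
  qed
  have e_in: "e i \<in> edges G" for i
  proof -
    have "e i = {c ! (i mod n), c ! (Suc (i mod n) mod n)}"
      by (simp add: e_def v_def mod_Suc_eq)
    moreover have "i mod n < n" using \<open>n \<ge> 3\<close> by simp
    ultimately have "e i \<in> cycle_edges c"
      unfolding cycle_edges_def n_def by blast
    then show ?thesis using c_edges by blast
  qed
  have e_eq_iff: "e i = e j \<longleftrightarrow> i mod n = j mod n" for i j
  proof
    assume "e i = e j"
    then have "i mod n = j mod n \<or> i mod n = Suc j mod n \<and> Suc i mod n = j mod n"
      by (auto simp: e_def doubleton_eq_iff v_eq_iff)
    \<comment> \<open>Equal edges with swapped ends would make two steps along the cycle return to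
      the start, which is impossible for n \<ge> 3.\<close>
    moreover have False if "i mod n = Suc j mod n" "Suc i mod n = j mod n"
    proof -
      define k where "k = j mod n"
      have "k < n" "Suc (Suc k mod n) mod n = k"
        using that \<open>n \<ge> 3\<close> by (simp_all add: k_def mod_Suc_eq) (metis mod_Suc_eq)
      then show False using \<open>n \<ge> 3\<close> by (auto simp: mod_Suc split: if_splits)
    qed
    ultimately show "i mod n = j mod n" by blast
  next
    assume "i mod n = j mod n"
    then show "e i = e j" by (simp add: e_def v_def) (metis mod_Suc_eq)
  qed
  have e_Suc: "e i \<noteq> e (Suc i)" for i
    using \<open>n \<ge> 3\<close> by (auto simp: e_eq_iff mod_Suc split: if_splits)
  have chord_unique: "f = g"
    if "f \<in> edges G - range e" "g \<in> edges G - range e" "v (Suc i) \<in> f" "v (Suc i) \<in> g" for f g i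
  proof (rule ccontr)
    \<comment> \<open>Two chords and the two cycle edges would be four edges at
      \<open>v (Suc i)\<close>.\<close>
    assume "f \<noteq> g"
    moreover have "f \<noteq> e k" "g \<noteq> e k" for k using that by auto
    ultimately have "card {f, g, e i, e (Suc i)} = 4"
      using e_Suc[of i] by simp
    moreover have "card {f, g, e i, e (Suc i)} \<le> card {f \<in> edges G. v (Suc i) \<in> f}"
      using that e_in \<open>finite (edges G)\<close> by (intro card_mono) (auto simp: e_def)
    ultimately show False using degree_le[OF v_in, of "Suc i"] by simp
  qed
  have mod_Suc_inject: "i mod n = j mod n" if "Suc i mod n = Suc j mod n" for i j
    using that \<open>n \<ge> 3\<close> by (auto simp: mod_Suc split: if_splits)
  have cycle_edge_at: "f = e i \<or> f = e (Suc i)" if f: "f \<in> range e" "v (Suc i) \<in> f" for f i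
  proof -
    obtain j where "f = e j" using f by blast
    then have "v (Suc i) = v j \<or> v (Suc i) = v (Suc j)" using f by (auto simp: e_def)
    then have "Suc i mod n = j mod n \<or> Suc i mod n = Suc j mod n" by (simp add: v_eq_iff)
    then show ?thesis using \<open>f = e j\<close> e_eq_iff mod_Suc_inject by metis
  qed

  \<comment> \<open>Where each chord is inserted\<close>
  define P where "P i f \<longleftrightarrow> f \<in> edges G - range e \<and> v (Suc i) \<in> f \<and> ({f, e i} \<in> M \<or> {f, e (Suc i)} \<in> M)"
    for i f
  \<comment> \<open>\<open>x i\<close> is what the walk visits between \<open>e i\<close> and
    \<open>e (Suc i)\<close>: the chord satisfying \<open>P i\<close>, unique by
    \<open>chord_unique\<close>, or nothing.\<close>
  define x where "x i = (if \<exists>f. P i f then [SOME f. P i f] else [])" for i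
  have x_eq: "x i = [f]" if "P i f" for i f
  proof -
    have "P i (SOME f. P i f)" using that by (rule someI)
    then have "(SOME f. P i f) = f" using that chord_unique[of _ f i] by (auto simp: P_def)
    then show ?thesis using that by (auto simp: x_def)
  qed
  have x_Nil: "x i = []" if "\<nexists>f. P i f" for i
    using that by (simp add: x_def)
  have x_cases: "x i = [] \<and> (\<nexists>f. P i f) \<or> (\<exists>f. x i = [f] \<and> P i f)" for i
    using x_eq x_Nil by blast
  have in_x_iff: "f \<in> set (x i) \<longleftrightarrow> P i f" for f i
    using x_cases[of i] x_eq by (metis empty_iff empty_set list.set_intros(1) set_ConsD)
  have pair_at: "\<exists>i<n. v (Suc i) \<in> f \<and> v (Suc i) \<in> g \<and> (f \<in> range e \<or> P i f) \<and> (g \<in> range e \<or> P i g)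
      \<and> (f \<in> range e \<or> g \<in> range e)"
    if "{f, g} \<in> M" "f \<noteq> g" for f g
  proof -
    have fg: "f \<in> edges G" "g \<in> edges G" "f \<inter> g \<noteq> {}"
      using M_pair[OF that(1), of f] that(2) by (auto simp: doubleton_eq_iff)
    then obtain w where "w \<in> f" "w \<in> g" by blast
    then obtain i where i: "i < n" "v (Suc i) \<in> f" "v (Suc i) \<in> g"
      using v_surj edge fg by blast
    \<comment> \<open>Two distinct chords cannot meet. If one member of the pair is a chord, the
      other is therefore a cycle edge at \<open>v (Suc i)\<close>, that is \<open>e i\<close> or
      \<open>e (Suc i)\<close>, and the chord satisfies \<open>P i\<close>.\<close>
    have "f \<in> range e \<or> g \<in> range e"
      using chord_unique[of f g i] fg i that(2) by blast
    then show ?thesis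
      using i fg that(1) cycle_edge_at[of f i] cycle_edge_at[of g i]
      by (intro exI[of _ i]) (auto simp: P_def insert_commute)
  qed
  \<comment> \<open>No chord is inserted twice: its partner in \<open>M\<close> is unique, and the
    two distinct edges share only one vertex.\<close>
  have P_unique: "i = j" if ij: "P i f" "P j f" "i < n" "j < n" for i j f
  proof -
    obtain k where k: "{f, e k} \<in> M" "v (Suc i) \<in> e k" using ij(1) v_in_e unfolding P_def by blast
    obtain l where l: "{f, e l} \<in> M" "v (Suc j) \<in> e l" using ij(2) v_in_e unfolding P_def by blast
    have f: "f \<in> edges G" "f \<noteq> e k" "v (Suc i) \<in> f" "v (Suc j) \<in> f"
      using ij(1,2) unfolding P_def by blast+
    have "{f, e k} = {f, e l}" using M_unique[OF k(1) l(1), of f] by simp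
    then have "e k = e l" by (metis doubleton_eq_iff)
    then have "v (Suc i) = v (Suc j)"
      using card_2_eq_if_common_points[OF edge(2)[OF f(1)] edge(2)[OF e_in] f(2,3) k(2) f(4)] l(2)
      by simp
    then have "i mod n = j mod n" by (rule mod_Suc_inject[OF iffD1[OF v_eq_iff]])
    then show ?thesis using ij(3,4) by simp
  qed

  \<comment> \<open>The hamiltonian cycle of the line graph\<close>
  define h where "h = concat (map (\<lambda>i. e i # x i) [0..<n])"
  have h_set: "set h = (\<Union>i<n. insert (e i) (set (x i)))"
    by (auto simp: h_def)
  have h_edges: "cycle_edges h = (\<Union>i<n. path_edges (e i # x i @ [e (Suc i)]))"
  proof -
    have "h \<noteq> []" and "hd h = e 0"
      using \<open>n \<ge> 3\<close> by (simp_all add: h_def upt_rec)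
    \<comment> \<open>The last block is closed with \<open>e n\<close>, which is the head of
      \<open>h\<close>, so the block edges include the edge closing the cycle.\<close>
    moreover have "e 0 = e n" by (simp add: e_eq_iff)
    ultimately show ?thesis
      using path_edges_concat[of e x n] by (simp add: cycle_edges_conv_path_edges h_def)
  qed
  have h_distinct: "distinct h"
    unfolding h_def
  proof (rule distinct_concat)
    have "inj_on (\<lambda>i. e i # x i) {..<n}"
      by (auto simp: inj_on_def e_eq_iff)
    then show "distinct (map (\<lambda>i. e i # x i) [0..<n])"
      by (simp add: distinct_map atLeast0LessThan)
  next
    fix ys assume "ys \<in> set (map (\<lambda>i. e i # x i) [0..<n])"
    then obtain i where "ys = e i # x i" by auto
    then show "distinct ys" using x_cases[of i] by (auto simp: P_def)
  next
    fix ys zs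
    assume "ys \<in> set (map (\<lambda>i. e i # x i) [0..<n])" "zs \<in> set (map (\<lambda>i. e i # x i) [0..<n])" "ys \<noteq> zs"
    then obtain i j where ij: "ys = e i # x i" "zs = e j # x j" "i < n" "j < n"
      unfolding set_map set_upt image_iff Bex_def atLeastLessThan_iff by blast
    with \<open>ys \<noteq> zs\<close> have "i \<noteq> j" by blast
    with ij have "e i \<noteq> e j" by (simp add: e_eq_iff)
    moreover have "e k \<notin> set (x l)" for k l by (auto simp: in_x_iff P_def)
    moreover have "set (x i) \<inter> set (x j) = {}"
      using P_unique ij \<open>i \<noteq> j\<close> by (auto simp: in_x_iff)
    ultimately show "set ys \<inter> set zs = {}" using ij by auto
  qed
  have h_verts: "set h = edges G"
  proof
    show "set h \<subseteq> edges G" using e_in by (auto simp: h_set in_x_iff P_def)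
    show "edges G \<subseteq> set h"
    proof
      fix f assume "f \<in> edges G"
      then obtain s where "s \<in> M" "f \<in> s" using M_cover by blast
      then obtain g where g: "{f, g} \<in> M" "f \<noteq> g" using M_pair by metis
      obtain i where i: "i < n" "f \<in> range e \<or> P i f"
        using pair_at[OF g] by blast
      have "e k \<in> set h" for k
      proof -
        have "e k = e (k mod n)" by (simp add: e_eq_iff)
        moreover have "k mod n < n" using \<open>n \<ge> 3\<close> by simp
        ultimately show ?thesis by (auto simp: h_set)
      qed
      then show "f \<in> set h" using i by (auto simp: h_set in_x_iff)
    qed
  qed
  have "3 \<le> length h"
  proof -
    have "inj_on e {..<n}" by (auto simp: inj_on_def e_eq_iff)
    then have "n = card (e ` {..<n})" by (simp add: card_image)
    also have "\<dots> \<le> card (set h)" by (intro card_mono) (auto simp: h_set)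
    also have "\<dots> \<le> length h" by (rule card_length)
    finally show ?thesis using \<open>n \<ge> 3\<close> by simp
  qed
  moreover have "cycle_edges h \<subseteq> edges (line_graph G)"
  proof -
    have adj: "{f, g} \<in> edges (line_graph G)"
      if "f \<in> edges G" "g \<in> edges G" "f \<noteq> g" "w \<in> f" "w \<in> g" for f g w
      using that by (auto simp: line_graph_def)
    \<comment> \<open>All members of this closed block contain \<open>v (Suc i)\<close>, so its
      consecutive members are adjacent in the line graph.\<close>
    have "path_edges (e i # x i @ [e (Suc i)]) \<subseteq> edges (line_graph G)" for i
      using x_cases[of i]
    proof (elim disjE exE conjE)
      assume "x i = []"
      then show ?thesis using adj[OF e_in e_in e_Suc, of "v (Suc i)"] by (simp add: e_def)
    next
      fix f assume "x i = [f]" "P i f"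
      moreover from this have "e k \<noteq> f" for k by (auto simp: P_def)
      ultimately show ?thesis
        using adj[OF e_in, of f i "v (Suc i)"] adj[OF _ e_in, of f "Suc i" "v (Suc i)"] v_in_e
        by (simp add: P_def eq_commute[of f])
    qed
    then show ?thesis by (auto simp: h_edges)
  qed
  moreover have "M \<subseteq> cycle_edges h"
  proof
    fix s assume s: "s \<in> M"
    have "s \<in> edges (line_graph G)" using M_line s by blast
    then obtain f g where fg: "s = {f, g}" "f \<noteq> g" by (auto simp: line_graph_def)
    obtain i where i: "i < n" "v (Suc i) \<in> f" "v (Suc i) \<in> g" "f \<in> range e \<or> P i f" "g \<in> range e \<or> P i g"
        "f \<in> range e \<or> g \<in> range e"
      using pair_at[of f g] s fg by blast
    \<comment> \<open>An inserted chord stands between \<open>e i\<close> and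
      \<open>e (Suc i)\<close>, so it is next to its partner whichever of the two that is.\<close>
    have chord: "s \<in> path_edges (e i # x i @ [e (Suc i)])" if "s = {a, b}" "P i a" "b = e i \<or> b = e (Suc i)" for a b
      using that x_eq[of i a] by (auto simp: insert_commute)
    have "s \<in> path_edges (e i # x i @ [e (Suc i)])"
    proof (cases "f \<in> range e \<and> g \<in> range e")
      case True
      then have s_eq: "s = {e i, e (Suc i)}"
        using cycle_edge_at[of f i] cycle_edge_at[of g i] i fg by auto
      have "\<not> P i a" for a
      proof
        assume a: "P i a"
        then obtain b where "{a, b} \<in> M" "b \<in> s" by (auto simp: P_def s_eq)
        then have "a \<in> s" using M_unique[OF _ s, of "{a, b}" b] by auto
        \<comment> \<open>By disjointness the pair of \<open>a\<close> is \<open>s\<close> itself,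
          yet \<open>s\<close> contains only cycle edges.\<close>
        then show False using a s_eq by (auto simp: P_def)
      qed
      then show ?thesis using x_Nil[of i] s_eq by simp
    next
      case False
      then show ?thesis
        using i fg chord[of f g] chord[of g f] cycle_edge_at[of f i] cycle_edge_at[of g i]
        by (auto simp: insert_commute)
    qed
    then show "s \<in> cycle_edges h" using i by (auto simp: h_edges)
  qed
  ultimately show "\<exists>c. hamiltonian_cycle (line_graph G) c \<and> M \<subseteq> cycle_edges c"
    using h_distinct h_verts
    by (intro exI[of _ h]) (auto simp: hamiltonian_cycle_def is_cycle_def line_graph_def)
qed

end
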